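(* For any $m,n\ge 1$, $a\in Perm(m)$ and $1\le i\le m$, the map $a\circ_i(-): Perm(n)\to Perm(m+n-1)$ is an injective lattice homomorphism with respect to the weak Bruhat orders.
   Context: $Perm(n)$ is the symmetric group on $\{1,\dots,n\}$, elements written in one-line notation. For $a=a_1\dots a_m\in Perm(m)$, $b=b_1\dots b_n\in Perm(n)$ and $1\le i\le m$, $$a\circ_i b:=a'_1\dots a'_{i-1}\,(b_1+a_i-1)\,(b_2+a_i-1)\dots(b_n+a_i-1)\,a'_{i+1}\dots a'_m,$$ where $a'_k=a_k+n-1$ if $a_k>a_i$ and $a'_k=a_k$ otherwise. The (right) weak Bruhat order on $Perm(n)$ is: $u\le v$ iff $Inv(u)\subseteq Inv(v)$, where $Inv(u)=\{(u_k,u_l)\mid k<l,\ u_k>u_l\}$. With this order $Perm(n)$ is a lattice; the join $b\vee c$ is the unique permutation whose inversion set is the transitive closure of $Inv(b)\cup Inv(c)$. *)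

theory Defs
  imports "HOL-Algebra.Lattice" "HOL-Combinatorics.Multiset_Permutations"
begin

(* Permutations of {1..n} are lists in one-line notation; letters and the index i of
   partial_comp are 1-based, so a_i is a ! (i - 1). *)

definition Perm :: "nat \<Rightarrow> nat list set" where
  "Perm n = permutations_of_set {1..n}"

(* Inversions are pairs of letters, not of positions. *)

definition Inv :: "nat list \<Rightarrow> (nat \<times> nat) set" where
  "Inv u = {(u ! k, u ! l) | k l. k < l \<and> l < length u \<and> u ! k > u ! l}"

definition weak_bruhat :: "nat \<Rightarrow> nat list gorder" where
  "weak_bruhat n = \<lparr>carrier = Perm n, eq = (=), le = (\<lambda>u v. Inv u \<subseteq> Inv v)\<rparr>"

(* The truncated subtractions are harmless for nonempty b and positive letters of a. *)

definition partial_comp :: "nat list \<Rightarrow> nat \<Rightarrow> nat list \<Rightarrow> nat list" where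
  "partial_comp a i b =
     (let n = length b;
          ai = a ! (i - 1);
          shift = (\<lambda>x. if x > ai then x + n - 1 else x)
      in map shift (take (i - 1) a) @ map (\<lambda>x. x + ai - 1) b @ map shift (drop i a))"

(* join_pres and meet_pres include that both orders are lattices. *)

definition lattice_hom ::
  "('a, 'c) gorder_scheme \<Rightarrow> ('b, 'd) gorder_scheme \<Rightarrow> ('a \<Rightarrow> 'b) \<Rightarrow> bool" where
  "lattice_hom L M f \<longleftrightarrow>
     f \<in> carrier L \<rightarrow> carrier M \<and> join_pres L M f \<and> meet_pres L M f"

end

theory Submission
  imports Defs
begin

text \<open>Permutations correspond to the transitive and cotransitive sets of decreasing pairs of letters,
  and reversing words complements inversion sets, so meets reduce to joins. Since the words
  \<open>a \<circ>\<^sub>i b\<close> agree outside the block of \<open>b\<close>, we have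
  \<open>Inv (a \<circ>\<^sub>i b) = K \<union> (Inv b shifted)\<close> with \<open>K\<close> independent of \<open>b\<close>. A transitive set containing
  \<open>K\<close> and the shifts of \<open>Inv b\<close> and \<open>Inv c\<close> contains the shift of the transitive closure of
  \<open>Inv b \<union> Inv c\<close>, which gives preservation of joins.\<close>

section \<open>Elementary properties of inversion sets\<close>

lemma PermD:
  assumes "u \<in> Perm n"
  shows "distinct u" "set u = {1..n}" "length u = n"
  using assms distinct_card[of u] by (auto simp: Perm_def permutations_of_set_def)

lemma PermI: "distinct u \<Longrightarrow> set u = {1..n} \<Longrightarrow> u \<in> Perm n"
  by (simp add: Perm_def permutations_of_set_def)

lemma rev_Perm_iff [simp]: "rev u \<in> Perm n \<longleftrightarrow> u \<in> Perm n"
  by (auto simp: Perm_def permutations_of_set_def)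

lemma Inv_Nil [simp]: "Inv [] = {}"
  by (simp add: Inv_def)

lemma Inv_Cons: "Inv (x # u) = {(x, y) | y. y \<in> set u \<and> y < x} \<union> Inv u" (is "?L = ?R")
proof (intro equalityI subsetI)
  fix p assume "p \<in> ?L"
  then obtain k l where "p = ((x # u) ! k, (x # u) ! l)" "k < l" "l < length (x # u)"
      "(x # u) ! k > (x # u) ! l"
    unfolding Inv_def by blast
  then show "p \<in> ?R"
    by (cases k; cases l) (auto simp: Inv_def)
next
  fix p assume "p \<in> ?R"
  then consider l where "p = (x, u ! l)" "l < length u" "u ! l < x"
    | k l where "p = (u ! k, u ! l)" "k < l" "l < length u" "u ! k > u ! l"
    unfolding Inv_def by (auto simp: in_set_conv_nth)
  then show "p \<in> ?L"
  proof cases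
    case 1
    then show ?thesis
      unfolding Inv_def by (intro CollectI exI[of _ 0] exI[of _ "Suc l"]) auto
  next
    case 2
    then show ?thesis
      unfolding Inv_def by (intro CollectI exI[of _ "Suc k"] exI[of _ "Suc l"]) auto
  qed
qed

lemma Inv_subset: "Inv u \<subseteq> {(x, y). x \<in> set u \<and> y \<in> set u \<and> y < x}"
  by (induction u) (auto simp: Inv_Cons)

lemma Inv_append:
  "Inv (u @ v) = Inv u \<union> Inv v \<union> {(x, y). x \<in> set u \<and> y \<in> set v \<and> y < x}"
  by (induction u) (auto simp: Inv_Cons)

lemma Inv_map_strict_mono:
  "strict_mono f \<Longrightarrow> Inv (map f u) = map_prod f f ` Inv u"
  by (induction u) (auto simp: Inv_Cons strict_mono_less image_Un image_iff)

text \<open>Reversal flips the relative position of every two distinct letters, so each decreasing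
  pair of letters is an inversion of exactly one of \<open>u\<close> and
  \<open>rev u\<close>.\<close>

lemma Inv_rev:
  assumes "distinct u"
  shows "Inv (rev u) = {(x, y). x \<in> set u \<and> y \<in> set u \<and> y < x} - Inv u"
  using assms
proof (induction u)
  case (Cons a u)
  then show ?case
    using Inv_subset[of u] by (auto simp: Inv_Cons Inv_append)
qed simp

text \<open>Without repetitions every letter has a single position, so "stands before" composes
  along a common middle letter.\<close>

lemma trans_Inv:
  assumes "distinct u"
  shows "trans (Inv u)"
  using assms
proof (induction u)
  case (Cons a u)
  then have "trans (Inv u)" "a \<notin> set u"
    by auto
  then show ?case
    using Inv_subset[of u] unfolding trans_def Inv_Cons
    by (auto 0 4)
qed simp

text \<open>Since \<open>x\<close> stands before \<open>z\<close>, any other letter \<open>y\<close>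
  stands after \<open>x\<close> or before \<open>z\<close>.\<close>

lemma cotrans_Inv:
  assumes "(x, z) \<in> Inv u" "z < y" "y < x" "y \<in> set u"
  shows "(x, y) \<in> Inv u \<or> (y, z) \<in> Inv u"
  using assms
proof (induction u)
  case (Cons a u)
  then show ?case
    using Inv_subset[of u] by (auto simp: Inv_Cons)
qed simp

text \<open>If the first letters \<open>x\<close> and \<open>y\<close> differed, each would precede
  the other in its own word, and the decreasing one of the pairs \<open>(x, y)\<close> and
  \<open>(y, x)\<close> would be an inversion of one word only. Once the heads agree, restricting to
  the remaining letters gives equal inversion sets of the tails.\<close>

lemma Inv_inject:
  assumes "distinct u" "distinct v" "set u = set v" "Inv u = Inv v"
  shows "u = v"
  using assms
proof (induction u arbitrary: v)
  case (Cons x u)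
  then obtain y w where v: "v = y # w"
    by (cases v) auto
  have restrict: "Inv t = Inv (z # t) \<inter> set t \<times> set t" if "z \<notin> set t" for z :: nat and t
    using that Inv_subset[of t] by (auto simp: Inv_Cons)
  have "x = y"
  proof (rule ccontr)
    assume "x \<noteq> y"
    then have mem: "y \<in> set u" "x \<in> set w"
      using Cons.prems v by auto
    have "x \<notin> set u" "y \<notin> set w"
      using Cons.prems v by auto
    then have "(y, x) \<notin> Inv (x # u)" "(x, y) \<notin> Inv (y # w)"
      using \<open>x \<noteq> y\<close> Inv_subset[of u] Inv_subset[of w] by (auto simp: Inv_Cons)
    moreover have "(x, y) \<in> Inv (x # u) \<or> (y, x) \<in> Inv (y # w)"
      using mem \<open>x \<noteq> y\<close> by (auto simp: Inv_Cons)
    ultimately show False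
      using Cons.prems(4) v by metis
  qed
  have "set u = set w"
    using Cons.prems v \<open>x = y\<close> by auto
  moreover have "Inv u = Inv w"
    using Cons.prems v \<open>x = y\<close> \<open>set u = set w\<close> restrict[of x u] restrict[of y w]
    by (metis distinct.simps(2))
  ultimately show ?case
    using Cons.IH[of w] Cons.prems v \<open>x = y\<close> by simp
qed simp

section \<open>Realizing transitive and cotransitive sets as inversion sets\<close>

text \<open>The relation below says that \<open>x\<close> stands before \<open>y\<close> in the word with inversion set \<open>I\<close>.\<close>

definition precedes :: "(nat \<times> nat) set \<Rightarrow> nat \<Rightarrow> nat \<Rightarrow> bool" where
  "precedes I x y \<longleftrightarrow> x < y \<and> (y, x) \<notin> I \<or> y < x \<and> (x, y) \<in> I"

text \<open>The sizes of \<open>x\<close>, \<open>y\<close>, \<open>z\<close> decide which closure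
  property acts. A decreasing chain needs transitivity, an increasing one cotransitivity at
  \<open>y\<close>. If \<open>y\<close> is the largest or the smallest letter, transitivity excludes
  \<open>(z, x)\<close> and cotransitivity supplies \<open>(x, z)\<close> when
  \<open>z < x\<close>.\<close>

lemma precedes_trans:
  assumes "I \<subseteq> {(x, y). x \<in> A \<and> y \<in> A \<and> y < x}" "trans I"
    and cotrans: "\<And>x y z. (x, z) \<in> I \<Longrightarrow> z < y \<Longrightarrow> y < x \<Longrightarrow> y \<in> A \<Longrightarrow> (x, y) \<in> I \<or> (y, z) \<in> I"
    and "precedes I x y" "precedes I y z" "x \<in> A" "y \<in> A" "z \<in> A"
  shows "precedes I x z"
proof -
  have tr: "(p, q) \<in> I \<Longrightarrow> (q, r) \<in> I \<Longrightarrow> (p, r) \<in> I" for p q r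
    using \<open>trans I\<close> by (rule transD)
  consider "x < y" "y < z" | "x < y" "z < y" | "y < x" "y < z" | "y < x" "z < y"
    using assms unfolding precedes_def by linarith
  then show ?thesis
  proof cases
    case 1
    then have "(z, x) \<notin> I"
      using assms(4,5,7) cotrans[of z x y] unfolding precedes_def by auto
    with 1 show ?thesis
      unfolding precedes_def by auto
  next
    case 2
    then have I: "(y, x) \<notin> I" "(y, z) \<in> I"
      using assms(4,5) unfolding precedes_def by auto
    then have "(z, x) \<notin> I" "x \<noteq> z" "z < x \<Longrightarrow> (x, z) \<in> I"
      using tr[of y z x] cotrans[of y z x] \<open>x < y\<close> \<open>x \<in> A\<close> by auto
    then show ?thesis
      unfolding precedes_def by auto
  next
    case 3
    then have I: "(x, y) \<in> I" "(z, y) \<notin> I"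
      using assms(4,5) unfolding precedes_def by auto
    then have "(z, x) \<notin> I" "x \<noteq> z" "z < x \<Longrightarrow> (x, z) \<in> I"
      using tr[of z x y] cotrans[of x y z] \<open>y < z\<close> \<open>z \<in> A\<close> by auto
    then show ?thesis
      unfolding precedes_def by auto
  next
    case 4
    then show ?thesis
      using assms(4,5) tr[of x y z] unfolding precedes_def by auto
  qed
qed

text \<open>A finite strict total order is listed by sorting along the number of predecessors, which
  strictly grows along \<open>R\<close>. The order on the type provides the initial enumeration of
  \<open>A\<close> that is then sorted.\<close>

lemma ex_sorted_wrt:
  fixes A :: "'a :: linorder set"
  assumes "finite A"
    and total: "\<And>x y. x \<in> A \<Longrightarrow> y \<in> A \<Longrightarrow> x \<noteq> y \<Longrightarrow> R x y \<or> R y x"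
    and irrefl: "\<And>x. x \<in> A \<Longrightarrow> \<not> R x x"
    and trans: "\<And>x y z. \<lbrakk>x \<in> A; y \<in> A; z \<in> A; R x y; R y z\<rbrakk> \<Longrightarrow> R x z"
  shows "\<exists>u. distinct u \<and> set u = A \<and> sorted_wrt R u"
proof -
  define rank where "rank x = card {y \<in> A. R y x}" for x
  have rank_less: "rank x < rank y" if "x \<in> A" "y \<in> A" "R x y" for x y
    unfolding rank_def
  proof (rule psubset_card_mono)
    show "{z \<in> A. R z x} \<subset> {z \<in> A. R z y}"
      using that trans irrefl by blast
  qed (use \<open>finite A\<close> in simp)
  define u where "u = sort_key rank (sorted_list_of_set A)"
  have u: "distinct u" "set u = A"
    using \<open>finite A\<close> by (simp_all add: u_def)
  have "R (u ! k) (u ! l)" if "k < l" "l < length u" for k l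
  proof -
    have "u ! k \<in> A" "u ! l \<in> A" "u ! k \<noteq> u ! l"
      using u that by (auto simp: nth_eq_iff_index_eq)
    moreover have "sorted_wrt (\<lambda>x y. rank x \<le> rank y) u"
      using sorted_sort_key[of rank "sorted_list_of_set A"] unfolding u_def sorted_wrt_map .
    then have "rank (u ! k) \<le> rank (u ! l)"
      using that by (rule sorted_wrt_nth_less)
    \<comment> \<open>By totality the alternative is \<open>R (u ! l) (u ! k)\<close>, which would
      give \<open>rank (u ! l) < rank (u ! k)\<close>.\<close>
    ultimately show ?thesis
      using total rank_less by (meson leD)
  qed
  then show ?thesis
    using u by (auto simp: sorted_wrt_iff_nth_less)
qed

text \<open>For a letter \<open>y\<close> listed after \<open>a\<close>, the relation forces
  \<open>(a, y)\<close> into \<open>I\<close> if \<open>y\<close> is smaller and keeps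
  \<open>(y, a)\<close> out of \<open>I\<close> if \<open>y\<close> is larger.\<close>

lemma Inv_sorted_wrt_precedes:
  assumes "sorted_wrt (precedes I) u" "I \<subseteq> {(x, y). y < x}"
  shows "Inv u = I \<inter> set u \<times> set u"
  using assms
proof (induction u)
  case (Cons a u)
  have "(y, a) \<notin> I" "(a, y) \<in> I \<longleftrightarrow> y < a" if "y \<in> set u" for y
    using Cons.prems that by (force simp: precedes_def)+
  moreover have "(a, a) \<notin> I"
    using Cons.prems(2) by auto
  moreover have "Inv u = I \<inter> set u \<times> set u"
    using Cons by simp
  ultimately show ?case
    by (auto simp: Inv_Cons)
qed simp

text \<open>This is the converse of \<open>trans_Inv\<close> and \<open>cotrans_Inv\<close>: under
  both closure properties \<open>precedes I\<close> is a strict total order on the letters, and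
  listing them in this order gives the permutation.\<close>

lemma ex_Perm_Inv:
  assumes "I \<subseteq> {(x, y). x \<in> {1..n} \<and> y \<in> {1..n} \<and> y < x}" "trans I"
    and "\<And>x y z. (x, z) \<in> I \<Longrightarrow> z < y \<Longrightarrow> y < x \<Longrightarrow> y \<in> {1..n} \<Longrightarrow> (x, y) \<in> I \<or> (y, z) \<in> I"
  shows "\<exists>u \<in> Perm n. Inv u = I"
proof -
  have "\<exists>u. distinct u \<and> set u = {1..n} \<and> sorted_wrt (precedes I) u"
  proof (rule ex_sorted_wrt)
    show "precedes I x z" if "x \<in> {1..n}" "y \<in> {1..n}" "z \<in> {1..n}" "precedes I x y" "precedes I y z" for x y z
      using precedes_trans[OF assms that(4,5,1-3)] by blast
  qed (auto simp: precedes_def)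
  then obtain u where u: "distinct u" "set u = {1..n}" "sorted_wrt (precedes I) u"
    by blast
  have "I \<subseteq> {(x, y). y < x}"
    using assms(1) by auto
  then have "Inv u = I"
    using Inv_sorted_wrt_precedes[OF u(3)] assms(1) u(2) by auto
  then show ?thesis
    using PermI[OF u(1,2)] by blast
qed

section \<open>Transitive closures of unions of inversion sets\<close>

text \<open>A descent from \<open>x\<close> to \<open>z\<close> either visits \<open>y\<close> or
  has an edge that jumps over it. That edge lies in \<open>A\<close> or in \<open>B\<close>, whose
  cotransitivity splits it at \<open>y\<close>; the rest of the path completes one of the two
  halves.\<close>

lemma cotrans_trancl_Un:
  fixes A B :: "(nat \<times> nat) set"
  assumes A: "\<And>x z. (x, z) \<in> A \<Longrightarrow> z < y \<Longrightarrow> y < x \<Longrightarrow> (x, y) \<in> A \<or> (y, z) \<in> A"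
    and B: "\<And>x z. (x, z) \<in> B \<Longrightarrow> z < y \<Longrightarrow> y < x \<Longrightarrow> (x, y) \<in> B \<or> (y, z) \<in> B"
    and "(x, z) \<in> (A \<union> B)\<^sup>+" "z < y" "y < x"
  shows "(x, y) \<in> (A \<union> B)\<^sup>+ \<or> (y, z) \<in> (A \<union> B)\<^sup>+"
  using assms(3-)
proof (induction rule: trancl_induct)
  case (base z)
  then show ?case using A B by blast
next
  case (step w z)
  have wz: "(w, y) \<in> A \<union> B \<or> (y, z) \<in> A \<union> B" if "y < w"
    using step.hyps(2) A[of w z] B[of w z] \<open>z < y\<close> that by auto
  consider "y < w" | "y = w" | "w < y" by linarith
  then show ?case
  proof cases
    case 1
    then show ?thesis
      using wz trancl_into_trancl[OF step.hyps(1), of y] by auto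
  next
    case 2
    then show ?thesis using step.hyps by blast
  next
    case 3
    then show ?thesis
      using step.IH[OF 3 \<open>y < x\<close>] trancl_into_trancl[OF _ step.hyps(2), of y] by auto
  qed
qed

lemma ex_Perm_Inv_join:
  assumes u: "u \<in> Perm n" and v: "v \<in> Perm n"
  shows "\<exists>w \<in> Perm n. Inv w = (Inv u \<union> Inv v)\<^sup>+"
proof (rule ex_Perm_Inv)
  define D where "D = {(x, y). x \<in> {1..n} \<and> y \<in> {1..n} \<and> y < x}"
  have "trans D"
    by (auto simp: D_def trans_def)
  moreover have "Inv u \<union> Inv v \<subseteq> D"
    using Inv_subset[of u] Inv_subset[of v] PermD(2)[OF u] PermD(2)[OF v] by (auto simp: D_def)
  ultimately show "(Inv u \<union> Inv v)\<^sup>+ \<subseteq> {(x, y). x \<in> {1..n} \<and> y \<in> {1..n} \<and> y < x}"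
    using trancl_mono_subset[of "Inv u \<union> Inv v" D] trancl_id[of D] by (simp add: D_def)
next
  fix x y z
  assume xz: "(x, z) \<in> (Inv u \<union> Inv v)\<^sup>+" "z < y" "y < x" and y: "y \<in> {1..n}"
  show "(x, y) \<in> (Inv u \<union> Inv v)\<^sup>+ \<or> (y, z) \<in> (Inv u \<union> Inv v)\<^sup>+"
  proof (rule cotrans_trancl_Un[OF _ _ xz])
    show "(p, y) \<in> Inv u \<or> (y, q) \<in> Inv u" if "(p, q) \<in> Inv u" "q < y" "y < p" for p q
      using cotrans_Inv[OF that] y PermD(2)[OF u] by blast
    show "(p, y) \<in> Inv v \<or> (y, q) \<in> Inv v" if "(p, q) \<in> Inv v" "q < y" "y < p" for p q
      using cotrans_Inv[OF that] y PermD(2)[OF v] by blast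
  qed
qed simp

section \<open>The weak order as a lattice\<close>

lemma weak_bruhat_simps [simp]:
  "carrier (weak_bruhat n) = Perm n"
  "(.=\<^bsub>weak_bruhat n\<^esub>) = (=)"
  "u \<sqsubseteq>\<^bsub>weak_bruhat n\<^esub> v \<longleftrightarrow> Inv u \<subseteq> Inv v"
  by (simp_all add: weak_bruhat_def)

lemma Inv_eq_iff:
  "u \<in> Perm n \<Longrightarrow> v \<in> Perm n \<Longrightarrow> Inv u = Inv v \<longleftrightarrow> u = v"
  using Inv_inject[of u v] PermD(1,2)[of u n] PermD(1,2)[of v n] by auto

lemma Inv_rev_subset_iff:
  assumes "u \<in> Perm n" "v \<in> Perm n"
  shows "Inv (rev u) \<subseteq> Inv (rev v) \<longleftrightarrow> Inv v \<subseteq> Inv u"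
proof -
  define D where "D = {(x, y). x \<in> {1..n} \<and> y \<in> {1..n} \<and> y < x}"
  have "Inv (rev u) = D - Inv u" "Inv (rev v) = D - Inv v"
    using Inv_rev[of u] Inv_rev[of v] PermD(1,2)[OF assms(1)] PermD(1,2)[OF assms(2)]
    by (simp_all add: D_def)
  moreover have "Inv u \<subseteq> D" "Inv v \<subseteq> D"
    using Inv_subset[of u] Inv_subset[of v] PermD(2)[OF assms(1)] PermD(2)[OF assms(2)]
    by (simp_all add: D_def)
  ultimately show ?thesis
    by (simp only: Diff_subset_conv) blast
qed

interpretation weak_bruhat: partial_order "weak_bruhat n"
  by unfold_locales (auto simp: Inv_eq_iff)

lemma mem_Upper_weak_bruhat:
  assumes "u \<in> Perm n" "v \<in> Perm n"
  shows "w \<in> Upper (weak_bruhat n) {u, v} \<longleftrightarrow> w \<in> Perm n \<and> Inv u \<subseteq> Inv w \<and> Inv v \<subseteq> Inv w"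
  using assms unfolding Upper_def by (simp only: weak_bruhat_simps) blast

lemma mem_Lower_weak_bruhat:
  assumes "u \<in> Perm n" "v \<in> Perm n"
  shows "w \<in> Lower (weak_bruhat n) {u, v} \<longleftrightarrow> w \<in> Perm n \<and> Inv w \<subseteq> Inv u \<and> Inv w \<subseteq> Inv v"
  using assms unfolding Lower_def by (simp only: weak_bruhat_simps) blast

text \<open>The inversion set of any upper bound is transitive and contains both given sets, hence
  also their transitive closure, and some permutation realizes exactly this closure.\<close>

lemma least_Upper_weak_bruhat_iff:
  assumes "u \<in> Perm n" "v \<in> Perm n"
  shows "least (weak_bruhat n) w (Upper (weak_bruhat n) {u, v}) \<longleftrightarrow>
    w \<in> Perm n \<and> Inv w = (Inv u \<union> Inv v)\<^sup>+"
proof -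
  obtain j where j: "j \<in> Perm n" "Inv j = (Inv u \<union> Inv v)\<^sup>+"
    using ex_Perm_Inv_join[OF assms] by blast
  have "least (weak_bruhat n) j (Upper (weak_bruhat n) {u, v})"
  proof (rule least_UpperI)
    fix x assume "x \<in> {u, v}"
    then show "x \<sqsubseteq>\<^bsub>weak_bruhat n\<^esub> j"
      using j by auto
  next
    fix y assume "y \<in> Upper (weak_bruhat n) {u, v}"
    then have y: "y \<in> Perm n" "Inv u \<union> Inv v \<subseteq> Inv y"
      using mem_Upper_weak_bruhat[OF assms] by auto
    then show "j \<sqsubseteq>\<^bsub>weak_bruhat n\<^esub> y"
      using trancl_id[OF trans_Inv[OF PermD(1)[OF y(1)]]] trancl_mono_subset[OF y(2)] j by simp
  qed (use assms j in auto)
  moreover from this have "w = j" if "least (weak_bruhat n) w (Upper (weak_bruhat n) {u, v})"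
    using that weak_bruhat.least_unique by blast
  moreover have "w = j" if "w \<in> Perm n" "Inv w = (Inv u \<union> Inv v)\<^sup>+"
    using that j Inv_eq_iff by metis
  ultimately show ?thesis
    using j by blast
qed

text \<open>Reversal is an order-reversing involution of \<open>Perm n\<close>, so it exchanges
  lower with upper bounds and greatest with least elements.\<close>

lemma greatest_Lower_weak_bruhat_iff:
  assumes "u \<in> Perm n" "v \<in> Perm n"
  shows "greatest (weak_bruhat n) w (Lower (weak_bruhat n) {u, v}) \<longleftrightarrow>
    least (weak_bruhat n) (rev w) (Upper (weak_bruhat n) {rev u, rev v})"
proof -
  have mem: "rev x \<in> Upper (weak_bruhat n) {rev u, rev v} \<longleftrightarrow> x \<in> Lower (weak_bruhat n) {u, v}" for x
    using assms Inv_rev_subset_iff[of _ n x] Inv_rev_subset_iff[of x n]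
    by (auto simp only: mem_Upper_weak_bruhat mem_Lower_weak_bruhat rev_Perm_iff)
  have Upper: "Upper (weak_bruhat n) {rev u, rev v} = rev ` Lower (weak_bruhat n) {u, v}"
  proof (intro equalityI subsetI)
    fix y assume "y \<in> Upper (weak_bruhat n) {rev u, rev v}"
    then show "y \<in> rev ` Lower (weak_bruhat n) {u, v}"
      using mem[of "rev y"] by (intro image_eqI[of _ _ "rev y"]) simp_all
  qed (use mem in blast)
  have le: "Inv (rev w) \<subseteq> Inv (rev x) \<longleftrightarrow> Inv x \<subseteq> Inv w"
    if "w \<in> Lower (weak_bruhat n) {u, v}" "x \<in> Lower (weak_bruhat n) {u, v}" for x
    using that Inv_rev_subset_iff[of w n x] by (simp only: mem_Lower_weak_bruhat[OF assms] simp_thms)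
  have "rev ` Lower (weak_bruhat n) {u, v} \<subseteq> Perm n" "Lower (weak_bruhat n) {u, v} \<subseteq> Perm n"
    by (auto simp: Lower_def)
  moreover have "rev w \<in> rev ` Lower (weak_bruhat n) {u, v} \<longleftrightarrow> w \<in> Lower (weak_bruhat n) {u, v}"
    by (simp add: inj_image_mem_iff)
  moreover have "(\<forall>y \<in> rev ` Lower (weak_bruhat n) {u, v}. Inv (rev w) \<subseteq> Inv y) \<longleftrightarrow>
      (\<forall>x \<in> Lower (weak_bruhat n) {u, v}. Inv x \<subseteq> Inv w)" if "w \<in> Lower (weak_bruhat n) {u, v}"
    by (simp only: ball_simps le[OF that] cong: ball_cong)
  ultimately show ?thesis
    unfolding least_def greatest_def Upper weak_bruhat_simps by metis
qed

interpretation weak_bruhat: lattice "weak_bruhat n"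
proof unfold_locales
  fix u v assume uv: "u \<in> carrier (weak_bruhat n)" "v \<in> carrier (weak_bruhat n)"
  then show "\<exists>s. least (weak_bruhat n) s (Upper (weak_bruhat n) {u, v})"
    using least_Upper_weak_bruhat_iff ex_Perm_Inv_join by (metis weak_bruhat_simps(1))
  \<comment> \<open>The witness is the reverse of the permutation realizing the join of
    \<open>rev u\<close> and \<open>rev v\<close>.\<close>
  from uv show "\<exists>s. greatest (weak_bruhat n) s (Lower (weak_bruhat n) {u, v})"
    using greatest_Lower_weak_bruhat_iff least_Upper_weak_bruhat_iff ex_Perm_Inv_join
    by (metis rev_Perm_iff rev_rev_ident weak_bruhat_simps(1))
qed

text \<open>The library's join is a chosen least upper bound; uniqueness of least elements makes the
  choice determinate.\<close>

lemma join_weak_bruhat_eq_iff: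
  assumes "u \<in> Perm n" "v \<in> Perm n"
  shows "u \<squnion>\<^bsub>weak_bruhat n\<^esub> v = w \<longleftrightarrow> least (weak_bruhat n) w (Upper (weak_bruhat n) {u, v})"
proof -
  have "least (weak_bruhat n) (u \<squnion>\<^bsub>weak_bruhat n\<^esub> v) (Upper (weak_bruhat n) {u, v})"
    unfolding join_def using assms by (intro weak_bruhat.sup_of_two_least) simp_all
  then show ?thesis
    using weak_bruhat.least_unique by blast
qed

lemma Inv_join:
  assumes "u \<in> Perm n" "v \<in> Perm n"
  shows "Inv (u \<squnion>\<^bsub>weak_bruhat n\<^esub> v) = (Inv u \<union> Inv v)\<^sup>+"
  using join_weak_bruhat_eq_iff[OF assms] least_Upper_weak_bruhat_iff[OF assms] by blast

lemma meet_weak_bruhat_eq_rev_join: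
  assumes "u \<in> Perm n" "v \<in> Perm n"
  shows "u \<sqinter>\<^bsub>weak_bruhat n\<^esub> v = rev (rev u \<squnion>\<^bsub>weak_bruhat n\<^esub> rev v)"
proof -
  let ?w = "rev (rev u \<squnion>\<^bsub>weak_bruhat n\<^esub> rev v)"
  have "greatest (weak_bruhat n) ?w (Lower (weak_bruhat n) {u, v})"
    \<comment> \<open>Feeding reflexivity into the characterization shows that the join of the
      reversed words is itself their least upper bound.\<close>
    using assms join_weak_bruhat_eq_iff[of "rev u" n "rev v", THEN iffD1, OF _ _ refl]
    by (simp add: greatest_Lower_weak_bruhat_iff)
  then show ?thesis
    using assms weak_bruhat.inf_of_two_greatest[of u n v] weak_bruhat.greatest_unique
    by (auto simp: meet_def)
qed

section \<open>Partial composition: range, injectivity and inversions\<close>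

text \<open>The block of \<open>b\<close> fills the interval from \<open>r\<close> to
  \<open>r + n - 1\<close>, the letters of \<open>a\<close> below \<open>r\<close> stay, and those
  above \<open>r\<close> move past the block.\<close>

lemma partial_comp_Perm:
  assumes a: "a \<in> Perm m" and b: "b \<in> Perm n" and "n \<ge> 1" "1 \<le> i" "i \<le> m"
  shows "partial_comp a i b \<in> Perm (m + n - 1)"
proof -
  define r where "r = a ! (i - 1)"
  define s where "s x = (if x > r then x + n - 1 else x)" for x
  have len: "length a = m" "length b = n"
    using PermD a b by auto
  have eq: "partial_comp a i b =
      map s (take (i - 1) a) @ map (\<lambda>x. x + r - 1) b @ map s (drop i a)"
    by (simp add: partial_comp_def Let_def len r_def s_def [abs_def])
  have split: "a = take (i - 1) a @ r # drop i a"
    using id_take_nth_drop[of "i - 1" a] assms len by (simp add: r_def)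
  have r: "r \<in> {1..m}"
    using PermD(2)[OF a] split by (metis in_set_conv_decomp)
  have "distinct (take (i - 1) a @ r # drop i a)" "set (take (i - 1) a @ r # drop i a) = {1..m}"
    using PermD[OF a] split by metis+
  then have rest: "set (take (i - 1) a) \<union> set (drop i a) = {1..m} - {r}"
    by auto
  have shift: "(\<lambda>x. x + r - 1) ` {1..n} = {r..r + n - 1}"
  proof (intro equalityI subsetI)
    fix y assume "y \<in> {r..r + n - 1}"
    then show "y \<in> (\<lambda>x. x + r - 1) ` {1..n}"
      using r \<open>n \<ge> 1\<close> by (intro image_eqI[of _ _ "y + 1 - r"]) auto
  qed (use r in auto)
  have image_s: "s ` ({1..m} - {r}) = {1..<r} \<union> {r + n..m + n - 1}"
  proof (intro equalityI subsetI)
    fix y assume y: "y \<in> {1..<r} \<union> {r + n..m + n - 1}"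
    show "y \<in> s ` ({1..m} - {r})"
    proof (cases "y < r")
      case True
      then show ?thesis
        using y r by (intro image_eqI[of _ _ y]) (auto simp: s_def)
    next
      case False
      then show ?thesis
        \<comment> \<open>Here \<open>y \<ge> r + n\<close>, so the preimage
          \<open>y + 1 - n\<close> exceeds \<open>r\<close> and is a letter that \<open>s\<close>
          moves.\<close>
        using y r \<open>n \<ge> 1\<close> by (intro image_eqI[of _ _ "y + 1 - n"]) (auto simp: s_def)
    qed
  qed (use r \<open>n \<ge> 1\<close> in \<open>auto simp: s_def split: if_splits\<close>)
  have "set (partial_comp a i b) =
      s ` (set (take (i - 1) a) \<union> set (drop i a)) \<union> (\<lambda>x. x + r - 1) ` set b"
    unfolding eq by auto
  also have "\<dots> = {1..<r} \<union> {r + n..m + n - 1} \<union> {r..r + n - 1}"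
    by (simp only: rest image_s shift PermD(2)[OF b])
  also have "\<dots> = {1..m + n - 1}"
    using r \<open>n \<ge> 1\<close> by auto
  finally have set: "set (partial_comp a i b) = {1..m + n - 1}" .
  moreover have "length (partial_comp a i b) = m + n - 1"
    using assms len by (simp add: eq)
  ultimately show ?thesis
    \<comment> \<open>Distinctness follows by counting: \<open>m + n - 1\<close> positions carry
      \<open>m + n - 1\<close> different letters.\<close>
    by (intro PermI card_distinct) simp_all
qed

text \<open>Words of equal length give the same prefix and suffix, which cancel. The shift of the
  block is injective because the letter of \<open>a\<close> at the insertion place is at least 1, so
  the subtraction never truncates.\<close>

lemma inj_on_partial_comp:
  assumes "a \<in> Perm m" "1 \<le> i" "i \<le> m"
  shows "inj_on (partial_comp a i) (Perm n)"
proof (rule inj_onI)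
  fix b c assume b: "b \<in> Perm n" and c: "c \<in> Perm n"
    and eq: "partial_comp a i b = partial_comp a i c"
  have "a ! (i - 1) \<in> set a"
    using assms PermD(3)[OF assms(1)] by simp
  then have "a ! (i - 1) \<ge> 1"
    using PermD(2)[OF assms(1)] by simp
  then have "inj (\<lambda>x. x + a ! (i - 1) - 1)"
    by (auto simp: inj_def)
  moreover have "length b = length c"
    using PermD(3) b c by metis
  ultimately show "b = c"
    using eq by (auto simp: partial_comp_def Let_def inj_map_eq_map)
qed

text \<open>Every inversion not inside the block depends on the prefix, the suffix and the set of
  letters of the block, and all three are the same for every \<open>b\<close> in
  \<open>Perm n\<close>. Inside the block a strictly monotone shift carries inversions to
  inversions.\<close>

lemma Inv_partial_comp:
  assumes a: "a \<in> Perm m" and "1 \<le> i" "i \<le> m"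
  obtains K f where "\<And>b. b \<in> Perm n \<Longrightarrow> Inv (partial_comp a i b) = K \<union> map_prod f f ` Inv b"
proof -
  define r where "r = a ! (i - 1)"
  \<comment> \<open>Shifting by \<open>n\<close> instead of \<open>length b\<close> makes
    \<open>P\<close>, \<open>Q\<close> and \<open>K\<close> visibly independent of
    \<open>b\<close>.\<close>
  define s where "s x = (if x > r then x + n - 1 else x)" for x
  define f where "f x = x + r - 1" for x
  define P where "P = map s (take (i - 1) a)"
  define Q where "Q = map s (drop i a)"
  define K where "K = Inv P \<union> Inv Q \<union> {(x, y). x \<in> set P \<and> y \<in> f ` {1..n} \<union> set Q \<and> y < x}
    \<union> {(x, y). x \<in> f ` {1..n} \<and> y \<in> set Q \<and> y < x}"
  have "r \<in> set a"
    using assms PermD(3)[OF a] by (simp add: r_def)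
  then have "r \<ge> 1"
    using PermD(2)[OF a] by simp
  then have "strict_mono f"
    by (auto simp: f_def strict_mono_def)
  have "Inv (partial_comp a i b) = K \<union> map_prod f f ` Inv b" if b: "b \<in> Perm n" for b
  proof -
    have "partial_comp a i b = P @ map f b @ Q"
      using PermD(3)[OF b] by (simp add: partial_comp_def Let_def P_def Q_def r_def s_def [abs_def] f_def [abs_def])
    then show ?thesis
      using PermD(2)[OF b] by (auto simp: Inv_append Inv_map_strict_mono[OF \<open>strict_mono f\<close>] K_def)
  qed
  then show thesis
    by (rule that)
qed

section \<open>Preservation of joins and meets\<close>

lemma partial_comp_join:
  assumes a: "a \<in> Perm m" and n: "n \<ge> 1" and i: "1 \<le> i" "i \<le> m"
    and b: "b \<in> Perm n" and c: "c \<in> Perm n"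
  shows "partial_comp a i (b \<squnion>\<^bsub>weak_bruhat n\<^esub> c) =
    partial_comp a i b \<squnion>\<^bsub>weak_bruhat (m + n - 1)\<^esub> partial_comp a i c"
proof -
  let ?g = "partial_comp a i" and ?j = "b \<squnion>\<^bsub>weak_bruhat n\<^esub> c"
  obtain K f where K: "\<And>b. b \<in> Perm n \<Longrightarrow> Inv (?g b) = K \<union> map_prod f f ` Inv b"
    using Inv_partial_comp[OF a i] by blast
  have j: "?j \<in> Perm n"
    using b c weak_bruhat.join_closed by simp
  note closed = partial_comp_Perm[OF a _ n i]
  have "(Inv (?g b) \<union> Inv (?g c))\<^sup>+ = Inv (?g ?j)"
  proof
    have "Inv (?g b) \<union> Inv (?g c) \<subseteq> Inv (?g ?j)"
      using K b c j Inv_join[OF b c] by auto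
    then show "(Inv (?g b) \<union> Inv (?g c))\<^sup>+ \<subseteq> Inv (?g ?j)"
      using trans_Inv[OF PermD(1)[OF closed[OF j]]] trancl_mono_subset trancl_id by metis
  next
    let ?T = "(Inv (?g b) \<union> Inv (?g c))\<^sup>+"
    \<comment> \<open>Each edge of a path in \<open>Inv b \<union> Inv c\<close> is carried by
      \<open>f\<close> to an edge in the union of the composed inversion sets, so paths go to
      paths.\<close>
    have "(f x, f y) \<in> ?T" if "(x, y) \<in> (Inv b \<union> Inv c)\<^sup>+" for x y
      using that
    proof (induction rule: trancl_induct)
      case (base y)
      then show ?case using K b c by (intro r_into_trancl') auto
    next
      case (step y z)
      then have "(f y, f z) \<in> Inv (?g b) \<union> Inv (?g c)"
        using K b c by auto
      with step.IH show ?case by (rule trancl_into_trancl)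
    qed
    moreover have "K \<subseteq> ?T"
      using K b by auto
    ultimately show "Inv (?g ?j) \<subseteq> ?T"
      using K[OF j] Inv_join[OF b c] by auto
  qed
  then have "?g b \<squnion>\<^bsub>weak_bruhat (m + n - 1)\<^esub> ?g c = ?g ?j"
    using closed[OF b] closed[OF c] closed[OF j]
    by (simp add: join_weak_bruhat_eq_iff least_Upper_weak_bruhat_iff)
  then show ?thesis ..
qed

text \<open>Reversal moves the insertion place to the mirrored position but keeps the letter found
  there, so all shifts are unchanged.\<close>

lemma rev_partial_comp:
  assumes "1 \<le> i" "i \<le> length a"
  shows "rev (partial_comp a i b) = partial_comp (rev a) (length a + 1 - i) (rev b)"
proof -
  have "rev a ! (length a - i) = a ! (i - 1)"
    using assms by (simp add: rev_nth)
  moreover have "take (length a - i) (rev a) = rev (drop i a)"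
    "drop (length a + 1 - i) (rev a) = rev (take (i - 1) a)"
    using assms by (simp_all add: rev_drop rev_take)
  ultimately show ?thesis
    using assms by (simp add: partial_comp_def Let_def rev_map)
qed

text \<open>Conjugating by reversal turns the meet into a join and insertion into \<open>a\<close>
  at \<open>i\<close> into insertion into \<open>rev a\<close> at \<open>m + 1 - i\<close>, where
  join preservation applies.\<close>

lemma partial_comp_meet:
  assumes a: "a \<in> Perm m" and n: "n \<ge> 1" and i: "1 \<le> i" "i \<le> m"
    and b: "b \<in> Perm n" and c: "c \<in> Perm n"
  shows "partial_comp a i (b \<sqinter>\<^bsub>weak_bruhat n\<^esub> c) =
    partial_comp a i b \<sqinter>\<^bsub>weak_bruhat (m + n - 1)\<^esub> partial_comp a i c"
proof -
  let ?g = "partial_comp a i" and ?h = "partial_comp (rev a) (m + 1 - i)"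
  have h: "?h (rev u) = rev (?g u)" for u
    using rev_partial_comp[of i a u] PermD(3)[OF a] i by simp
  have "?g (b \<sqinter>\<^bsub>weak_bruhat n\<^esub> c) = rev (?h (rev b \<squnion>\<^bsub>weak_bruhat n\<^esub> rev c))"
    using h[of "rev (rev b \<squnion>\<^bsub>weak_bruhat n\<^esub> rev c)"] meet_weak_bruhat_eq_rev_join[OF b c] by simp
  also have "\<dots> = rev (?h (rev b) \<squnion>\<^bsub>weak_bruhat (m + n - 1)\<^esub> ?h (rev c))"
    using partial_comp_join[of "rev a" m n "m + 1 - i" "rev b" "rev c"] a b c n i by simp
  also have "\<dots> = ?g b \<sqinter>\<^bsub>weak_bruhat (m + n - 1)\<^esub> ?g c"
    using meet_weak_bruhat_eq_rev_join partial_comp_Perm[OF a _ n i] b c h by simp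
  finally show ?thesis .
qed

theorem proposition4p3:
  fixes m n i :: nat and a :: "nat list"
  assumes "m \<ge> 1" and "n \<ge> 1"
    and "a \<in> Perm m"
    and "1 \<le> i" and "i \<le> m"
  shows "lattice_hom (weak_bruhat n) (weak_bruhat (m + n - 1)) (partial_comp a i)
       \<and> inj_on (partial_comp a i) (Perm n)"
  \<comment> \<open>The interpreted \<open>lattice_axioms\<close> discharge the requirement in
    \<open>join_pres\<close> and \<open>meet_pres\<close> that both orders are lattices.\<close>
  using assms partial_comp_Perm partial_comp_join partial_comp_meet inj_on_partial_comp
    weak_bruhat.lattice_axioms
  by (simp add: lattice_hom_def join_pres_def meet_pres_def)

end
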